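(* Let $P=(V,\leq)$ be a finite ordered set and let $x,y\in V$ be incomparable. Suppose that one of the following holds for $P$ or for its dual $P^*$: (i) there exists $z\in V$ such that $x<z$, $y$ is incomparable to both $x$ and $z$, and $\{x,y\}$ is autonomous in $P\setminus\{z\}$; (ii) there exist $z,t\in V$ such that $x<z$, $y<t$, $y$ is incomparable to $z$, $x$ is incomparable to $t$, and $\{x,y\}$ is autonomous in $P\setminus\{z,t\}$; (iii) there exist $z,t\in V$ such that $t<x<z$, $y$ is incomparable to both $t$ and $z$, and $\{x,y\}$ is autonomous in $P\setminus\{z,t\}$. Then $(x,y)$ is balanced in $P$, i.e. $\frac13\leq \mathbb{P}(x\prec y)\leq\frac23$.
   Context: $\mathbb{P}(x\prec y)$ denotes the proportion of linear extensions of $P$ that put $x$ before $y$. $P\setminus S$ denotes the suborder induced on $V\setminus S$. The dual $P^*$ is the order on $V$ with $x\leq y$ in $P^*$ iff $y\leq x$ in $P$. A subset $A$ of the ground set of an ordered set $R$ is autonomous in $R$ if for every element $v\notin A$ of $R$ and all $a,a'\in A$: ($v<a\Rightarrow v<a'$) and ($a<v\Rightarrow a'<v$). *)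

theory Defs
  imports Complex_Main
begin

text \<open>A finite ordered set is a finite ground set \<^term>\<open>V\<close> together with a relation
  \<^term>\<open>r\<close> satisfying \<^term>\<open>partial_order_on V r\<close>. Its dual is the converse of
  \<^term>\<open>r\<close>, and the suborder induced on \<^term>\<open>W\<close> is \<^term>\<open>Restr r W\<close>.\<close>

definition less_in :: "'a rel \<Rightarrow> 'a \<Rightarrow> 'a \<Rightarrow> bool" where
  "less_in r a b \<longleftrightarrow> (a, b) \<in> r \<and> a \<noteq> b"

definition incomparable :: "'a rel \<Rightarrow> 'a \<Rightarrow> 'a \<Rightarrow> bool" where
  "incomparable r a b \<longleftrightarrow> (a, b) \<notin> r \<and> (b, a) \<notin> r"

definition autonomous :: "'a set \<Rightarrow> 'a rel \<Rightarrow> 'a set \<Rightarrow> bool" where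
  "autonomous W r A \<longleftrightarrow>
     A \<subseteq> W \<and>
     (\<forall>v\<in>W - A. \<forall>a\<in>A. \<forall>a'\<in>A.
        (less_in r v a \<longrightarrow> less_in r v a') \<and> (less_in r a v \<longrightarrow> less_in r a' v))"

definition linear_extensions :: "'a set \<Rightarrow> 'a rel \<Rightarrow> 'a rel set" where
  "linear_extensions V r = {L. linear_order_on V L \<and> r \<subseteq> L}"

definition prob_before :: "'a set \<Rightarrow> 'a rel \<Rightarrow> 'a \<Rightarrow> 'a \<Rightarrow> real" where
  "prob_before V r x y =
     real (card {L \<in> linear_extensions V r. less_in L x y}) / real (card (linear_extensions V r))"

definition balanced :: "'a set \<Rightarrow> 'a rel \<Rightarrow> 'a \<Rightarrow> 'a \<Rightarrow> bool" where
  "balanced V r x y \<longleftrightarrow> 1/3 \<le> prob_before V r x y \<and> prob_before V r x y \<le> 2/3"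

end

theory Submission
  imports Defs "HOL-Combinatorics.Transposition"
begin

text \<open>Condition (ii) is symmetric under exchanging \<open>x\<close> with \<open>y\<close> and \<open>z\<close> with \<open>t\<close>,
  condition (iii) under duality. So in each case it suffices to bound one of the two numbers of
  linear extensions by twice the other (in case (i) the remaining bound holds because
  exchanging \<open>x\<close> and \<open>y\<close> is always possible when \<open>y\<close> comes first). A linear extension
  with \<open>x \<prec> y \<prec> z\<close> becomes one with \<open>y \<prec> x\<close> by exchanging \<open>x\<close> and \<open>y\<close>, and one
  with \<open>x \<prec> z \<prec> y\<close> becomes one with \<open>x \<prec> y \<prec> z\<close> by exchanging \<open>z\<close> and \<open>y\<close>:
  every element above \<open>z\<close> is above \<open>x\<close>, hence above \<open>y\<close>, and every element below \<open>y\<close>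
  is below \<open>x\<close>, so nothing placed between \<open>z\<close> and \<open>y\<close> obstructs the exchange.\<close>

section \<open>Existence and finiteness of linear extensions\<close>

text \<open>Guarantees a nonzero denominator in \<open>prob_before\<close>. Sorting by the size of
  the down-set extends the order; an arbitrary enumeration breaks ties.\<close>

lemma linear_extension_exists:
  assumes "finite V" and "partial_order_on V r"
  shows "linear_extensions V r \<noteq> {}"
proof -
  have rV: "r \<subseteq> V \<times> V" and refl: "refl_on V r" and tr: "trans r" and anti: "antisym r"
    using assms(2) by (auto simp: partial_order_on_def preorder_on_def)
  obtain h :: "'a \<Rightarrow> nat" and K where hK: "h ` V = {i. i < K}" and h: "inj_on h V"
    using finite_imp_inj_to_nat_seg[OF assms(1)] by metis
  define c where "c a = card {v\<in>V. (v, a) \<in> r}" for a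
  define g where "g a = c a * K + h a" for a
  have hlt: "h a < K" if "a \<in> V" for a
    using hK that by blast
  have g_inj: "a = b" if "a \<in> V" "b \<in> V" "g a = g b" for a b
  proof -
    have "h a = g a mod K" "h b = g b mod K"
      using hlt[OF that(1)] hlt[OF that(2)] by (simp_all add: g_def)
    then have "h a = h b"
      using that(3) by simp
    then show ?thesis
      using h that by (auto dest: inj_onD)
  qed
  have g_mono: "g a \<le> g b" if ab: "(a, b) \<in> r" for a b
  proof (cases "a = b")
    case False
    have V: "a \<in> V" "b \<in> V"
      using ab rV by auto
    have "(b, a) \<notin> r"
      using anti ab False by (meson antisymD)
    moreover have "(b, b) \<in> r"
      using refl V by (simp add: refl_on_def)
    ultimately have "{v\<in>V. (v, a) \<in> r} \<subset> {v\<in>V. (v, b) \<in> r}"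
      using tr ab V by (auto dest: transD)
    then have "c a < c b"
      unfolding c_def using assms(1) by (intro psubset_card_mono) auto
    \<comment> \<open>A gain of one in \<open>c\<close> adds \<open>K\<close> to the key, which
      outweighs any difference of labels.\<close>
    then have "Suc (c a) * K \<le> c b * K"
      by (intro mult_le_mono) auto
    then show ?thesis
      using hlt[OF V(1)] by (simp add: g_def)
  qed simp
  let ?L = "{(a, b). a \<in> V \<and> b \<in> V \<and> g a \<le> g b}"
  have "linear_order_on V ?L"
    using g_inj
    by (auto simp: linear_order_on_def partial_order_on_def preorder_on_def refl_on_def
        total_on_def intro!: transI antisymI)
  moreover have "r \<subseteq> ?L"
    using rV g_mono by auto
  ultimately show ?thesis
    unfolding linear_extensions_def by blast
qed

lemma finite_linear_extensions:
  assumes "finite V"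
  shows "finite (linear_extensions V r)"
proof (rule finite_subset)
  show "linear_extensions V r \<subseteq> Pow (V \<times> V)"
    by (auto simp: linear_extensions_def linear_order_on_def partial_order_on_def preorder_on_def)
qed (use assms in simp)

lemma linear_extensionD:
  assumes "L \<in> linear_extensions V r"
  shows "r \<subseteq> L" "L \<subseteq> V \<times> V" "trans L" "antisym L" "total_on V L" "refl_on V L"
  using assms
  by (auto simp: linear_extensions_def linear_order_on_def partial_order_on_def preorder_on_def)

section \<open>Exchanging two elements of a linear extension\<close>

text \<open>The inverse image is \<open>L\<close> with the positions of \<open>u\<close> and
  \<open>w\<close> exchanged. Upper bounds of \<open>w\<close> and lower bounds of \<open>u\<close>
  stay in order by transitivity. Upper bounds of \<open>u\<close> must already lie after
  \<open>w\<close>, and lower bounds of \<open>w\<close> before \<open>u\<close>, which is what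
  \<open>between\<close> ensures.\<close>

lemma inv_image_transpose_linear_extension:
  assumes L: "L \<in> linear_extensions V r"
    and uw: "less_in L u w" "(u, w) \<notin> r"
    and between: "\<And>v. less_in L u v \<Longrightarrow> less_in L v w \<Longrightarrow> (u, v) \<notin> r \<and> (v, w) \<notin> r"
  shows "inv_image L (transpose u w) \<in> linear_extensions V r"
proof -
  note LD = linear_extensionD[OF L]
  have uV: "u \<in> V" "w \<in> V"
    using uw LD(2) by (auto simp: less_in_def)
  have inV: "transpose u w a \<in> V \<longleftrightarrow> a \<in> V" for a
    using uV by (auto simp: transpose_def)
  have LV: "a \<in> V" "b \<in> V" if "(transpose u w a, transpose u w b) \<in> L" for a b
    using that LD(2) inV by blast+
  have "linear_order_on V (inv_image L (transpose u w))"
    unfolding linear_order_on_def partial_order_on_def preorder_on_def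
  proof (intro conjI)
    show "inv_image L (transpose u w) \<subseteq> V \<times> V"
      using LV by auto
    show "refl_on V (inv_image L (transpose u w))"
      using LD(6) inV by (auto simp: refl_on_def)
    show "trans (inv_image L (transpose u w))"
      using LD(3) by (rule trans_inv_image)
    show "antisym (inv_image L (transpose u w))"
      using LD(4) by (auto simp: antisym_def dest!: transpose_eq_imp_eq)
    show "total_on V (inv_image L (transpose u w))"
      unfolding total_on_def in_inv_image
    proof (intro ballI impI)
      fix a b
      assume "a \<in> V" "b \<in> V" "a \<noteq> b"
      then have "transpose u w a \<in> V" "transpose u w b \<in> V" "transpose u w a \<noteq> transpose u w b"
        using inV by (auto dest: transpose_eq_imp_eq)
      then show "(transpose u w a, transpose u w b) \<in> L \<or> (transpose u w b, transpose u w a) \<in> L"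
        using LD(5) by (auto simp: total_on_def)
    qed
  qed
  moreover have "(transpose u w a, transpose u w b) \<in> L" if ab: "(a, b) \<in> r" for a b
  proof -
    have abL: "(a, b) \<in> L" and V: "a \<in> V" "b \<in> V"
      using ab LD(1,2) by auto
    have uwL: "(u, w) \<in> L" "u \<noteq> w" "(w, u) \<notin> L"
      using uw(1) LD(4) by (auto simp: less_in_def dest: antisymD)
    have linear: "(c, d) \<in> L \<or> (d, c) \<in> L" if "c \<in> V" "d \<in> V" for c d
      using that LD(5,6) by (cases "c = d") (auto simp: total_on_def refl_on_def)
    have ne: "\<not> (a = u \<and> b = w)" "\<not> (a = w \<and> b = u)"
      using ab uw(2) abL uwL(3) by auto
    consider "a = b" | "a = u" "b \<noteq> u" "b \<noteq> w" | "a = w" "b \<noteq> u" "b \<noteq> w"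
      | "b = u" "a \<noteq> u" "a \<noteq> w" | "b = w" "a \<noteq> u" "a \<noteq> w"
      | "a \<noteq> u" "a \<noteq> w" "b \<noteq> u" "b \<noteq> w"
      using ne by argo
    then show ?thesis
    proof cases
      case 1
      then show ?thesis
        using V inV LD(6) by (simp add: refl_on_def)
    next
      case 2
      \<comment> \<open>Otherwise \<open>b\<close>, which is above \<open>u\<close> in
        \<open>r\<close>, would lie strictly between \<open>u\<close> and \<open>w\<close> in
        \<open>L\<close>.\<close>
      then have "(b, w) \<notin> L"
        using between[of b] ab abL by (auto simp: less_in_def)
      then show ?thesis
        using 2 linear[of b w] V uV by auto
    next
      case 3
      then show ?thesis
        using abL uwL(1) LD(3) by (auto dest: transD)
    next
      case 4
      then show ?thesis
        using abL uwL(1) LD(3) by (auto dest: transD)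
    next
      case 5
      then have "(u, a) \<notin> L"
        using between[of a] ab abL by (auto simp: less_in_def)
      then show ?thesis
        using 5 linear[of u a] V uV by auto
    next
      case 6
      then show ?thesis
        using abL by simp
    qed
  qed
  ultimately show ?thesis
    by (auto simp: linear_extensions_def)
qed

text \<open>A transposition is an involution, so exchanging positions is injective on
  relations.\<close>

lemma card_le_by_transpose:
  assumes "finite V" and "B \<subseteq> linear_extensions V r"
    and "\<And>L. L \<in> A \<Longrightarrow> inv_image L (transpose u w) \<in> B"
  shows "card A \<le> card B"
proof (rule card_inj_on_le)
  have "inv_image (inv_image L (transpose u w)) (transpose u w) = L" for L
    by (auto simp: inv_image_def)
  then show "inj_on (\<lambda>L. inv_image L (transpose u w)) A"
    by (metis inj_onI)
  show "(\<lambda>L. inv_image L (transpose u w)) ` A \<subseteq> B"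
    using assms(3) by auto
  show "finite B"
    using assms(1,2) finite_linear_extensions finite_subset by blast
qed

section \<open>Comparing the two counts\<close>

definition num_before :: "'a set \<Rightarrow> 'a rel \<Rightarrow> 'a \<Rightarrow> 'a \<Rightarrow> nat" where
  "num_before V r x y = card {L \<in> linear_extensions V r. less_in L x y}"

text \<open>Exchanging \<open>x\<close> and \<open>y\<close> always works here: an element above
  \<open>x\<close> is above \<open>y\<close>, hence not before \<open>y\<close> in \<open>L\<close>,
  and dually for elements below \<open>y\<close>.\<close>

lemma num_before_le:
  assumes "finite V" and "incomparable r x y"
    and up: "\<And>v. less_in r x v \<Longrightarrow> less_in r y v"
    and down: "\<And>v. less_in r v y \<Longrightarrow> less_in r v x"
  shows "num_before V r x y \<le> num_before V r y x"
  unfolding num_before_def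
proof (rule card_le_by_transpose[OF assms(1)])
  fix L
  assume "L \<in> {L \<in> linear_extensions V r. less_in L x y}"
  then have L: "L \<in> linear_extensions V r" and xy: "less_in L x y"
    by auto
  note LD = linear_extensionD[OF L]
  have "inv_image L (transpose x y) \<in> linear_extensions V r"
  proof (rule inv_image_transpose_linear_extension[OF L xy])
    show "(x, y) \<notin> r"
      using assms(2) by (simp add: incomparable_def)
    fix v
    assume "less_in L x v" "less_in L v y"
    then show "(x, v) \<notin> r \<and> (v, y) \<notin> r"
      using up[of v] down[of v] LD(1) antisymD[OF LD(4)] unfolding less_in_def by blast
  qed
  then show "inv_image L (transpose x y) \<in> {L \<in> linear_extensions V r. less_in L y x}"
    using xy by (auto simp: less_in_def)
qed auto

text \<open>Here \<open>z\<close> is the one exception to \<open>up\<close>. The factor 2 comes from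
  the injections of \<open>?B\<close> into \<open>?A\<close> and of \<open>?A\<close> into the
  extensions with \<open>y\<close> before \<open>x\<close>.\<close>

lemma num_before_le_double:
  assumes "finite V" and r: "partial_order_on V r" and "incomparable r x y"
    and xz: "less_in r x z" and yz: "incomparable r y z"
    and up: "\<And>v. v \<noteq> z \<Longrightarrow> less_in r x v \<Longrightarrow> less_in r y v"
    and down: "\<And>v. less_in r v y \<Longrightarrow> less_in r v x"
  shows "num_before V r x y \<le> 2 * num_before V r y x"
proof -
  let ?E = "linear_extensions V r"
  let ?A = "{L \<in> ?E. less_in L x y \<and> less_in L y z}"
  let ?B = "{L \<in> ?E. less_in L x y \<and> less_in L z y}"
  have rV: "r \<subseteq> V \<times> V" and tr: "trans r" and anti: "antisym r"
    using r by (auto simp: partial_order_on_def preorder_on_def)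
  have A: "card ?A \<le> num_before V r y x"
    unfolding num_before_def
  proof (rule card_le_by_transpose[OF assms(1)])
    fix L
    assume "L \<in> ?A"
    then have L: "L \<in> ?E" and xy: "less_in L x y" and yzL: "less_in L y z"
      by auto
    note LD = linear_extensionD[OF L]
    have "inv_image L (transpose x y) \<in> ?E"
    proof (rule inv_image_transpose_linear_extension[OF L xy])
      show "(x, y) \<notin> r"
        using assms(3) by (simp add: incomparable_def)
      fix v
      assume v: "less_in L x v" "less_in L v y"
      \<comment> \<open>In \<open>?A\<close> the exception \<open>z\<close> comes after
        \<open>y\<close>, so it is not between \<open>x\<close> and \<open>y\<close>.\<close>
      then have "v \<noteq> z"
        using yzL antisymD[OF LD(4)] unfolding less_in_def by blast
      then show "(x, v) \<notin> r \<and> (v, y) \<notin> r"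
        using v up[of v] down[of v] LD(1) antisymD[OF LD(4)] unfolding less_in_def by blast
    qed
    then show "inv_image L (transpose x y) \<in> {L \<in> ?E. less_in L y x}"
      using xy by (auto simp: less_in_def)
  qed auto
  have B: "card ?B \<le> card ?A"
  proof (rule card_le_by_transpose[OF assms(1)])
    fix L
    assume "L \<in> ?B"
    then have L: "L \<in> ?E" and xy: "less_in L x y" and zy: "less_in L z y"
      by auto
    note LD = linear_extensionD[OF L]
    have xzL: "less_in L x z"
      using xz LD(1) by (auto simp: less_in_def)
    have "inv_image L (transpose z y) \<in> ?E"
    proof (rule inv_image_transpose_linear_extension[OF L zy])
      show "(z, y) \<notin> r"
        using yz by (simp add: incomparable_def)
      fix v
      assume v: "less_in L z v" "less_in L v y"
      have "less_in r x v" if "(z, v) \<in> r"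
        using that v xz transD[OF tr] antisymD[OF anti] unfolding less_in_def by blast
      then have "(z, v) \<notin> r"
        using v up[of v] LD(1) antisymD[OF LD(4)] unfolding less_in_def by blast
      \<comment> \<open>By \<open>down\<close>, such a \<open>v\<close> would be below
        \<open>x\<close>, hence before \<open>z\<close> in \<open>L\<close>.\<close>
      moreover have "(v, y) \<notin> r"
        using v xzL down[of v] LD(1) antisymD[OF LD(4)] transD[OF LD(3)]
        unfolding less_in_def by blast
      ultimately show "(z, v) \<notin> r \<and> (v, y) \<notin> r" ..
    qed
    then show "inv_image L (transpose z y) \<in> ?A"
      using xy zy xzL by (auto simp: less_in_def transpose_def)
  qed auto
  have "less_in L y z \<or> less_in L z y" if "L \<in> ?E" "less_in L x y" for L
  proof -
    note LD = linear_extensionD[OF that(1)]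
    \<comment> \<open>Reflexivity makes elements of \<open>V\<close> comparable to themselves, so
      incomparable elements are distinct.\<close>
    have "y \<in> V" "z \<in> V" "y \<noteq> z"
      using that(2) LD(2) xz yz rV r
      by (auto simp: less_in_def incomparable_def partial_order_on_def preorder_on_def refl_on_def)
    then show ?thesis
      using LD(5) by (auto simp: total_on_def less_in_def)
  qed
  then have "{L \<in> ?E. less_in L x y} = ?A \<union> ?B"
    by auto
  then have "num_before V r x y \<le> card ?A + card ?B"
    unfolding num_before_def by (simp add: card_Un_le)
  then show ?thesis
    using A B by simp
qed

section \<open>Duality and the passage to probabilities\<close>

text \<open>Reversal is a bijection between the linear extensions of an order and those of its
  dual.\<close>

lemma num_before_converse: "num_before V (r\<inverse>) x y = num_before V r y x"
proof -
  have E: "L\<inverse> \<in> linear_extensions V (s\<inverse>) \<longleftrightarrow> L \<in> linear_extensions V s" for L s :: "'a rel"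
    by (auto simp: linear_extensions_def)
  have "{L \<in> linear_extensions V (r\<inverse>). less_in L x y}
      = converse ` {L \<in> linear_extensions V r. less_in L y x}" (is "?A = converse ` ?B")
  proof (intro subset_antisym subsetI)
    fix L
    assume "L \<in> ?A"
    then have "L\<inverse> \<in> ?B"
      using E[of "L\<inverse>" r] by (auto simp: less_in_def)
    then show "L \<in> converse ` ?B"
      by (metis converse_converse image_eqI)
  qed (use E in \<open>auto simp: less_in_def\<close>)
  moreover have "inj_on converse ?B"
    by (auto intro: inj_onI)
  ultimately show ?thesis
    unfolding num_before_def by (simp add: card_image)
qed

text \<open>With counts \<open>a\<close> and \<open>b\<close> and total \<open>a + b\<close>, the
  bound \<open>a \<le> 2 * b\<close> says that \<open>a\<close> is at most two thirds of the total,
  and \<open>b \<le> 2 * a\<close> that it is at least one third.\<close>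

lemma balanced_if_num_before:
  assumes "finite V" and "partial_order_on V r" and "x \<in> V" "y \<in> V" "x \<noteq> y"
    and "num_before V r x y \<le> 2 * num_before V r y x"
    and "num_before V r y x \<le> 2 * num_before V r x y"
  shows "balanced V r x y"
proof -
  let ?E = "linear_extensions V r"
  have "less_in L x y \<or> less_in L y x" if "L \<in> ?E" for L
    using linear_extensionD(5)[OF that] assms(3-5) by (auto simp: total_on_def less_in_def)
  then have "?E = {L \<in> ?E. less_in L x y} \<union> {L \<in> ?E. less_in L y x}"
    by auto
  moreover have "{L \<in> ?E. less_in L x y} \<inter> {L \<in> ?E. less_in L y x} = {}"
    using linear_extensionD(4) by (fastforce simp: less_in_def dest: antisymD)
  ultimately have sum: "card ?E = num_before V r x y + num_before V r y x"
    unfolding num_before_def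
    using card_Un_disjoint finite_linear_extensions[OF assms(1)]
    by (metis (no_types, lifting) finite_Un)
  have "real (card ?E) > 0"
    using linear_extension_exists[OF assms(1,2)] finite_linear_extensions[OF assms(1)]
    by (simp add: card_gt_0_iff)
  then show ?thesis
    using assms(6,7) sum unfolding balanced_def prob_before_def num_before_def[symmetric]
    by (simp add: le_divide_eq divide_le_eq)
qed

section \<open>The three cases and their duals\<close>

text \<open>For \<open>v\<close> outside \<open>V\<close> or equal to \<open>x\<close> or
  \<open>y\<close>, both sides of each equivalence are false, so the case analysis only has to treat
  the elements of \<open>S\<close> separately.\<close>

lemma autonomous_pairD:
  assumes "autonomous (V - S) (Restr r (V - S)) {x, y}" and "r \<subseteq> V \<times> V" and "incomparable r x y"
    and "v \<notin> S"
  shows "less_in r x v \<longleftrightarrow> less_in r y v" "less_in r v x \<longleftrightarrow> less_in r v y"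
proof -
  have xy: "x \<in> V - S" "y \<in> V - S"
    using assms(1) by (auto simp: autonomous_def)
  have *: "less_in (Restr r (V - S)) a b \<longleftrightarrow> less_in r a b" if "a \<in> V - S" "b \<in> V - S" for a b
    using that by (auto simp: less_in_def)
  have "(less_in r x v \<longleftrightarrow> less_in r y v) \<and> (less_in r v x \<longleftrightarrow> less_in r v y)"
  proof (cases "v \<in> V \<and> v \<noteq> x \<and> v \<noteq> y")
    case True
    then have "v \<in> (V - S) - {x, y}"
      using assms(4) by auto
    then show ?thesis
      using assms(1) xy * unfolding autonomous_def by blast
  next
    case False
    then show ?thesis
      using assms(2,3) by (auto simp: less_in_def incomparable_def)
  qed
  then show "less_in r x v \<longleftrightarrow> less_in r y v" "less_in r v x \<longleftrightarrow> less_in r v y"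
    by auto
qed

lemma num_before_bounds:
  assumes fin: "finite V" and r: "partial_order_on V r" and xy: "incomparable r x y"
    and cases: "(\<exists>z\<in>V. less_in r x z \<and> incomparable r y x \<and> incomparable r y z \<and>
         autonomous (V - {z}) (Restr r (V - {z})) {x, y}) \<or>
      (\<exists>z\<in>V. \<exists>t\<in>V. less_in r x z \<and> less_in r y t \<and>
         incomparable r y z \<and> incomparable r x t \<and>
         autonomous (V - {z, t}) (Restr r (V - {z, t})) {x, y}) \<or>
      (\<exists>z\<in>V. \<exists>t\<in>V. less_in r t x \<and> less_in r x z \<and>
         incomparable r y t \<and> incomparable r y z \<and>
         autonomous (V - {z, t}) (Restr r (V - {z, t})) {x, y})"
  shows "num_before V r x y \<le> 2 * num_before V r y x \<and>
    num_before V r y x \<le> 2 * num_before V r x y"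
proof -
  have rV: "r \<subseteq> V \<times> V" and anti: "antisym r"
    using r by (auto simp: partial_order_on_def preorder_on_def)
  have yx: "incomparable r y x"
    using xy by (auto simp: incomparable_def)
  note inc = less_in_def incomparable_def
  from cases show ?thesis
  proof (elim disjE bexE conjE)
    fix z
    assume z: "less_in r x z" "incomparable r y z"
      and aut: "autonomous (V - {z}) (Restr r (V - {z})) {x, y}"
    note D = autonomous_pairD[OF aut rV xy]
    have "num_before V r x y \<le> 2 * num_before V r y x"
    proof (rule num_before_le_double[OF fin r xy z])
      show "less_in r v x" if "less_in r v y" for v
        using that D(2)[of v] z by (cases "v = z") (auto simp: inc)
    qed (use D in auto)
    moreover have "num_before V r y x \<le> num_before V r x y"
    proof (rule num_before_le[OF fin yx])
      show "less_in r x v" if "less_in r y v" for v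
        using that D(1)[of v] z by (cases "v = z") auto
      show "less_in r v y" if "less_in r v x" for v
        using that D(2)[of v] z antisymD[OF anti] by (cases "v = z") (auto simp: inc)
    qed
    ultimately show ?thesis
      by simp
  next
    fix z t
    assume z: "less_in r x z" "incomparable r y z" and t: "less_in r y t" "incomparable r x t"
      and aut: "autonomous (V - {z, t}) (Restr r (V - {z, t})) {x, y}"
    note D = autonomous_pairD[OF aut rV xy]
    have "num_before V r x y \<le> 2 * num_before V r y x"
    proof (rule num_before_le_double[OF fin r xy z])
      show "less_in r y v" if "v \<noteq> z" "less_in r x v" for v
        using that D(1)[of v] t by (cases "v = t") auto
      \<comment> \<open>Neither exception can be below \<open>y\<close>: \<open>z\<close> is
        incomparable to it and \<open>t\<close> is above it.\<close>
      show "less_in r v x" if "less_in r v y" for v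
        using that D(2)[of v] z t antisymD[OF anti]
        by (cases "v = z"; cases "v = t") (auto simp: inc)
    qed
    moreover have "num_before V r y x \<le> 2 * num_before V r x y"
    proof (rule num_before_le_double[OF fin r yx t])
      show "less_in r x v" if "v \<noteq> t" "less_in r y v" for v
        using that D(1)[of v] z by (cases "v = z") auto
      show "less_in r v y" if "less_in r v x" for v
        using that D(2)[of v] z t antisymD[OF anti]
        by (cases "v = z"; cases "v = t") (auto simp: inc)
    qed
    ultimately show ?thesis ..
  next
    fix z t
    assume z: "less_in r x z" "incomparable r y z" and t: "less_in r t x" "incomparable r y t"
      and aut: "autonomous (V - {z, t}) (Restr r (V - {z, t})) {x, y}"
    note D = autonomous_pairD[OF aut rV xy]
    have "num_before V r x y \<le> 2 * num_before V r y x"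
    proof (rule num_before_le_double[OF fin r xy z])
      show "less_in r y v" if "v \<noteq> z" "less_in r x v" for v
        using that D(1)[of v] t antisymD[OF anti] by (cases "v = t") (auto simp: inc)
      show "less_in r v x" if "less_in r v y" for v
        using that D(2)[of v] z t by (cases "v = z"; cases "v = t") (auto simp: inc)
    qed
    \<comment> \<open>In the dual, \<open>t\<close> lies above \<open>x\<close> and takes the role
      of \<open>z\<close>; translated back, this is the other bound.\<close>
    moreover have "num_before V (r\<inverse>) x y \<le> 2 * num_before V (r\<inverse>) y x"
    proof (rule num_before_le_double[OF fin])
      have conv: "less_in (r\<inverse>) a b \<longleftrightarrow> less_in r b a" for a b
        by (auto simp: less_in_def)
      show "partial_order_on V (r\<inverse>)" "incomparable (r\<inverse>) x y"
        "less_in (r\<inverse>) x t" "incomparable (r\<inverse>) y t"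
        using r xy t by (auto simp: inc)
      show "less_in (r\<inverse>) y v" if "v \<noteq> t" "less_in (r\<inverse>) x v" for v
        using that D(2)[of v] z antisymD[OF anti]
        unfolding conv by (cases "v = z") (auto simp: inc)
      show "less_in (r\<inverse>) v x" if "less_in (r\<inverse>) v y" for v
        using that D(1)[of v] z t
        unfolding conv by (cases "v = z"; cases "v = t") (auto simp: inc)
    qed
    ultimately show ?thesis
      by (simp add: num_before_converse)
  qed
qed

theorem theorem2:
  fixes V :: "'a set" and r :: "'a rel" and x y :: 'a
  assumes "finite V"
    and "partial_order_on V r"
    and "x \<in> V" and "y \<in> V"
    and "incomparable r x y"
    and "\<exists>R\<in>{r, r\<inverse>}.
      (\<exists>z\<in>V. less_in R x z \<and> incomparable R y x \<and> incomparable R y z \<and>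
         autonomous (V - {z}) (Restr R (V - {z})) {x, y}) \<or>
      (\<exists>z\<in>V. \<exists>t\<in>V. less_in R x z \<and> less_in R y t \<and>
         incomparable R y z \<and> incomparable R x t \<and>
         autonomous (V - {z, t}) (Restr R (V - {z, t})) {x, y}) \<or>
      (\<exists>z\<in>V. \<exists>t\<in>V. less_in R t x \<and> less_in R x z \<and>
         incomparable R y t \<and> incomparable R y z \<and>
         autonomous (V - {z, t}) (Restr R (V - {z, t})) {x, y})"
  shows "balanced V r x y"
proof -
  \<comment> \<open>Passing to the dual swaps the two inequalities, so their conjunction for
    \<open>R\<close> gives that for \<open>r\<close>.\<close>
  have bounds: "num_before V r x y \<le> 2 * num_before V r y x \<and>
    num_before V r y x \<le> 2 * num_before V r x y"
    using assms(6)
  proof (elim bexE)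
    fix R
    assume R: "R \<in> {r, r\<inverse>}"
    then have "partial_order_on V R" "incomparable R x y"
      using assms(2,5) by (auto simp: incomparable_def)
    note bd = num_before_bounds[OF assms(1) this]
    show ?thesis if "(\<exists>z\<in>V. less_in R x z \<and> incomparable R y x \<and> incomparable R y z \<and>
         autonomous (V - {z}) (Restr R (V - {z})) {x, y}) \<or>
      (\<exists>z\<in>V. \<exists>t\<in>V. less_in R x z \<and> less_in R y t \<and>
         incomparable R y z \<and> incomparable R x t \<and>
         autonomous (V - {z, t}) (Restr R (V - {z, t})) {x, y}) \<or>
      (\<exists>z\<in>V. \<exists>t\<in>V. less_in R t x \<and> less_in R x z \<and>
         incomparable R y t \<and> incomparable R y z \<and>
         autonomous (V - {z, t}) (Restr R (V - {z, t})) {x, y})"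
      using bd[OF that] R by (auto simp: num_before_converse)
  qed
  moreover have "x \<noteq> y"
    using assms(2,3,5)
    by (auto simp: incomparable_def partial_order_on_def preorder_on_def refl_on_def)
  ultimately show ?thesis
    using balanced_if_num_before[OF assms(1-4)] by simp
qed

end
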